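(* Let $p\ge 0$, $\mu>0$, $r>0$ and $q>-\mu-\tfrac12$ be real, and let $C>0$ (possibly depending on $\mu$ and $r$) be such that $$|J_{\mu-\frac12}(rx)|\le C\,x^{q}\qquad\text{for all } x>0 .$$ Put $a=\frac p2$, $b=\frac p4(1+\mathrm{e}^2)$ and $$K_1=\left(\frac{b}{\mathrm{e}^b-1}-\frac{a}{\mathrm{e}^a-1}\right)\frac{1}{b-a},\qquad K_2=\left(\frac{1}{\mathrm{e}^a-1}-\frac{1}{\mathrm{e}^b-1}\right)\frac{ab}{b-a}.$$ Then $$\begin{aligned} |S_{\mu,p}(r)|&\le \frac{C\sqrt{\pi}\,p^{\mu+q+\frac12}}{\mathrm{e}^2\,2^{2\mu+q}\,r^{\mu-\frac12}\,\Gamma(\mu+1)}\Bigg\{\frac{1}{2(\mu+q)+5}\left(\frac{4}{2(\mu+q)+3}+\frac{p}{\mathrm{e}^{\frac p2}-1}\right)\\ &\quad+\frac{2K_1\,p}{2(\mu+q)+5}\left(\Big(\frac{1+\mathrm{e}^2}{2}\Big)^{\mu+q+\frac52}-1\right)+\frac{4K_2}{2(\mu+q)+3}\left(\Big(\frac{1+\mathrm{e}^2}{2}\Big)^{\mu+q+\frac32}-1\right)\\ &\quad-\frac{(1+\mathrm{e}^2)\,p}{2\,[2(\mu+q)+1]\,\big(\mathrm{e}^{\frac p4(1+\mathrm{e}^2)}-1\big)}\left(\Big(\frac{1+\mathrm{e}^2}{2}\Big)^{\mu+q+\frac12}-1\right)\\ &\quad-\frac{\mathrm{e}^2\,p\,(1+\mathrm{e}^2)^{\mu+q+\frac32}}{2^{\mu+q+\frac32}\,[2(\mu+q)+1]\,\big(\mathrm{e}^{\frac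 p4(1+\mathrm{e}^2)}-1\big)}\Bigg\}\\ &\quad+\frac{C\sqrt{\pi}}{(2r)^{\mu-\frac12}\,\Gamma(\mu+1)}\,\Gamma\Big(\mu+q+\frac32\Big)\,\zeta\Big(\mu+q+\frac32\Big). \end{aligned}$$ For $p=0$ the right-hand side is understood as its limit as $p\to 0+$, in which the first summand (the one containing the braces) equals $0$.
   Context: $J_\nu$ is the Bessel function of the first kind and $\zeta$ is the Riemann zeta function. The $p$-extended Riemann zeta function is $$\zeta_p(\alpha)=\frac{1}{\Gamma(\alpha)}\int_0^\infty \frac{x^{\alpha-1}\,\mathrm{e}^{-\frac{p}{x}}}{\mathrm{e}^x-1}\,\mathrm{d}x ,$$ for $\Re(p)>0$, or for $p=0$ and $\Re(\alpha)>1$. The $p$-extended Mathieu series is defined, for $\mu>0$ and real $|r|<1$, by $$S_{\mu,p}(r)=2\sum_{n\ge 0}(-1)^n\, r^{2n}\binom{\mu+n}{n}\,\zeta_p(2\mu+2n+1),\qquad \binom{a}{b}=\frac{\Gamma(a+1)}{\Gamma(b+1)\Gamma(a-b+1)},$$ and for $r\ge 1$ (where this series diverges) $S_{\mu,p}(r)$ is understood as $$S_{\mu,p}(r)=\frac{\sqrt{\pi}}{(2r)^{\mu-\frac12}\,\Gamma(\mu+1)}\int_0^\infty \frac{x^{\mu+\frac12}\,\mathrm{e}^{-\frac{p}{x}}}{\mathrm{e}^x-1}\,J_{\mu-\frac12}(rx)\,\mathrm{d}x .$$ *)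

theory Defs
  imports "HOL-Analysis.Analysis"
begin

(* Ascending series of the Bessel function of the first kind.  rGamma = 1/Gamma vanishes at the
   poles of Gamma, so every real order is covered.  Meaningful for x > 0 only:
   0 powr a = 0 in HOL, so in particular the value at x = 0 for \<nu> = 0 is not J_0(0) = 1. *)
definition bessel_J :: "real \<Rightarrow> real \<Rightarrow> real" where
  "bessel_J \<nu> x =
     (\<Sum>k. (-1) ^ k / fact k * rGamma (\<nu> + real k + 1) * (x / 2) powr (\<nu> + 2 * real k))"

(* The Dirichlet series of the Riemann zeta function; equal to it for s > 1. *)
definition riemann_zeta :: "real \<Rightarrow> real" where
  "riemann_zeta s = (\<Sum>n. 1 / real (Suc n) powr s)"

(* Meaningful for Re p > 0, and for p = 0 with Re \<alpha> > 1 (absolutely convergent integral). *)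
definition extended_zeta :: "complex \<Rightarrow> complex \<Rightarrow> complex" where
  "extended_zeta p \<alpha> = 1 / Gamma \<alpha> *
     (LBINT x:{0<..}. of_real x powr (\<alpha> - 1) * exp (- p / of_real x) / (exp (of_real x) - 1))"

definition gamma_binomial :: "real \<Rightarrow> real \<Rightarrow> real" where
  "gamma_binomial a b = Gamma (a + 1) / (Gamma (b + 1) * Gamma (a - b + 1))"

(* The second branch is meant for r \<ge> 1, where the series diverges; values at r \<le> -1 carry
   no meaning. *)
definition extended_mathieu :: "real \<Rightarrow> complex \<Rightarrow> real \<Rightarrow> complex" where
  "extended_mathieu \<mu> p r =
     (if \<bar>r\<bar> < 1 then
        2 * (\<Sum>n. (-1) ^ n * of_real (r ^ (2 * n)) * of_real (gamma_binomial (\<mu> + real n) (real n))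
                * extended_zeta p (of_real (2 * \<mu> + 2 * real n + 1)))
      else
        of_real (sqrt pi / ((2 * r) powr (\<mu> - 1 / 2) * Gamma (\<mu> + 1))) *
        (LBINT x:{0<..}. of_real (x powr (\<mu> + 1 / 2)) * exp (- p / of_real x) / (exp (of_real x) - 1)
                * of_real (bessel_J (\<mu> - 1 / 2) (r * x))))"

end

theory Submission
  imports Defs
begin

text \<open>
  Write \<open>s = \<mu> + q + 1/2\<close>, \<open>a = p/2\<close>, \<open>\<beta> = (1 + e\<^sup>2)/2\<close>, \<open>b = a \<beta>\<close> and \<open>f x = x / (e\<^sup>x - 1)\<close>.

  For every \<open>r > 0\<close> the extended Mathieu series is, up to the factor
  \<open>\<surd>\<pi> / ((2r)\<^bsup>\<mu> - 1/2\<^esup> \<Gamma>(\<mu> + 1))\<close>, the integral of \<open>x\<^bsup>\<mu> + 1/2\<^esup> e\<^bsup>-p/x\<^esup> / (e\<^sup>x - 1) \<cdot> J(r x)\<close> over the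
  positive half-line with \<open>J\<close> of order \<open>\<mu> - 1/2\<close>. For \<open>r \<ge> 1\<close> this is the definition. For \<open>r < 1\<close>
  Legendre's duplication formula turns the terms of the Mathieu series into moments of the terms of
  the Bessel series; the interchange of sum and integral is justified by the convergence of
  \<open>\<Sum> r\<^bsup>2n\<^esup> (\<mu>+n choose n)\<close>, a binomial series in \<open>r\<^sup>2 < 1\<close>. The hypothesis on the Bessel function
  then reduces everything to the moment \<open>I(p) = \<integral> x\<^sup>s e\<^bsup>-p/x\<^esup> / (e\<^sup>x - 1) dx\<close>.

  For \<open>p = 0\<close>, \<open>I(0) = \<Gamma>(s + 1) \<zeta>(s + 1)\<close> by expanding \<open>1 / (e\<^sup>x - 1)\<close> in a geometric series.
  For \<open>p > 0\<close> the function \<open>E x = e\<^bsup>-p/x\<^esup>\<close> has its inflection point at \<open>a\<close>, with \<open>E a = e\<^bsup>-2\<^esup>\<close>. It is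
  majorised by its chord \<open>e\<^bsup>-2\<^esup> x/a\<close> on \<open>(0, a]\<close>, by its tangent \<open>e\<^bsup>-2\<^esup> (2x/a - 1)\<close> at \<open>a\<close> to the right of
  \<open>a\<close>, and by \<open>1\<close> everywhere; the tangent reaches the value \<open>1\<close> exactly at \<open>b\<close>. The function \<open>f\<close> is
  convex and decreasing with limit \<open>1\<close> at \<open>0\<close>, so it lies below its chords on \<open>[0, a]\<close> and \<open>[a, b]\<close>
  (the latter is \<open>K1 x + K2\<close>) and above \<open>f b\<close> on \<open>(0, b]\<close>. The upper bounds are inserted where \<open>f\<close> occurs
  with a positive sign, and the lower bound \<open>f b\<close> in the negative part of the tangent and in the part
  \<open>\<integral>\<^sub>0\<^sup>b\<close> that is missing from \<open>\<Gamma>(s + 1) \<zeta>(s + 1)\<close>. What remains are integrals of powers, and their sum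
  is the expression in braces times \<open>e\<^bsup>-2\<^esup> a\<^sup>s\<close>.
\<close>

section \<open>Chords of \<open>x / (e\<^sup>x - 1)\<close>\<close>

text \<open>
  The numerator of the second derivative of \<open>x / (e\<^sup>x - 1)\<close>. Its own derivative \<open>(x - 1) e\<^sup>x + 1\<close> is
  nonnegative because \<open>1 - x \<le> e\<^bsup>-x\<^esup>\<close>.
\<close>
lemma bernoulli_quotient_deriv2_numerator_nonneg:
  fixes x :: real
  assumes "x \<ge> 0"
  shows "0 \<le> (x - 2) * exp x + x + 2"
proof -
  have d: "((\<lambda>x. (x - 2) * exp x + x + 2)
      has_real_derivative ((x - 1) * exp x + 1)) (at x)" for x :: real
    by (auto intro!: derivative_eq_intros simp: algebra_simps)
  have n: "(x - 1) * exp x + 1 \<ge> 0" for x :: real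
  proof -
    have "(1 - x) * exp x \<le> exp (-x) * exp x"
      using exp_ge_add_one_self[of "-x"] by (intro mult_right_mono) auto
    then show ?thesis by (simp add: exp_minus algebra_simps)
  qed
  have "(0 - 2) * exp 0 + 0 + 2 \<le> (x - 2) * exp x + x + 2"
    using assms d n
    by (intro DERIV_nonneg_imp_nondecreasing[of 0 x "\<lambda>x. (x - 2) * exp x + x + 2"]) blast+
  then show ?thesis by simp
qed

lemma convex_on_bernoulli_quotient:
  "convex_on {0<..} (\<lambda>x::real. x / (exp x - 1))"
proof (rule f''_ge0_imp_convex)
  fix x :: real assume "x \<in> {0<..}"
  then have x: "x > 0" "exp x - 1 > 0" by auto
  show "((\<lambda>x. x / (exp x - 1)) has_real_derivative ((1 - x) * exp x - 1) / (exp x - 1) ^ 2) (at x)"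
    using x by (auto intro!: derivative_eq_intros simp: field_simps power2_eq_square)
  show "((\<lambda>x. ((1 - x) * exp x - 1) / (exp x - 1) ^ 2) has_real_derivative
      (exp x * ((x - 2) * exp x + x + 2) / (exp x - 1) ^ 3)) (at x)"
  proof (rule DERIV_cong)
    show "((\<lambda>x. ((1 - x) * exp x - 1) / (exp x - 1) ^ 2) has_real_derivative
      ((- x * exp x) * (exp x - 1) ^ 2 - ((1 - x) * exp x - 1) * (2 * (exp x - 1) * exp x))
        / ((exp x - 1) ^ 2 * (exp x - 1) ^ 2)) (at x)"
    proof (rule DERIV_divide)
      show "((\<lambda>x. (1 - x) * exp x - 1) has_real_derivative (- x * exp x)) (at x)"
        by (auto intro!: derivative_eq_intros simp: algebra_simps)
      show "((\<lambda>x. (exp x - 1) ^ 2) has_real_derivative (2 * (exp x - 1) * exp x)) (at x)"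
        by (auto intro!: derivative_eq_intros)
    qed (use x in simp)
    have "((- x * e) * u ^ 2 - ((1 - x) * e - 1) * (2 * u * e)) / (u ^ 2 * u ^ 2)
        = e * ((x - 2) * e + x + 2) / u ^ 3" if "u = e - 1" "u > 0" for e u :: real
    proof -
      have "(- x * e) * u ^ 2 - ((1 - x) * e - 1) * (2 * u * e) = u * (e * ((x - 2) * e + x + 2))"
        unfolding that(1) by algebra
      then show ?thesis using that(2) by (simp add: eval_nat_numeral)
    qed
    from this[OF refl x(2)]
    show "((- x * exp x) * (exp x - 1) ^ 2 - ((1 - x) * exp x - 1) * (2 * (exp x - 1) * exp x))
          / ((exp x - 1) ^ 2 * (exp x - 1) ^ 2)
        = exp x * ((x - 2) * exp x + x + 2) / (exp x - 1) ^ 3" .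
  qed
  show "exp x * ((x - 2) * exp x + x + 2) / (exp x - 1) ^ 3 \<ge> 0"
    using x bernoulli_quotient_deriv2_numerator_nonneg[of x] by simp
qed simp

lemma bernoulli_quotient_antimono:
  fixes x y :: real
  assumes "0 < x" "x \<le> y"
  shows "y / (exp y - 1) \<le> x / (exp x - 1)"
proof (rule DERIV_nonpos_imp_nonincreasing[OF assms(2)])
  fix t assume "x \<le> t" "t \<le> y"
  then have t: "t > 0" "exp t - 1 > 0" using assms by auto
  have "((\<lambda>x. x / (exp x - 1)) has_real_derivative ((1 - t) * exp t - 1) / (exp t - 1) ^ 2) (at t)"
    using t by (auto intro!: derivative_eq_intros simp: field_simps power2_eq_square)
  moreover have "(1 - t) * exp t \<le> exp (-t) * exp t"
    using exp_ge_add_one_self[of "-t"] by (intro mult_right_mono) auto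
  then have "((1 - t) * exp t - 1) / (exp t - 1) ^ 2 \<le> 0"
    using t by (intro divide_nonpos_nonneg) (auto simp: exp_minus)
  ultimately show "\<exists>y. ((\<lambda>x. x / (exp x - 1)) has_real_derivative y) (at t) \<and> y \<le> 0" by blast
qed

lemma bernoulli_quotient_le_chord:
  fixes a b x :: real
  assumes "0 < a" "a < b" "a \<le> x" "x \<le> b"
  defines "f \<equiv> \<lambda>x::real. x / (exp x - 1)"
  shows "f x \<le> (f b - f a) / (b - a) * (x - a) + f a"
proof -
  have "convex_on {a..b} f"
    unfolding f_def using assms(1)
    by (intro convex_on_subset[OF convex_on_bernoulli_quotient]) auto
  from convex_onD_Icc'[OF this, of x] show ?thesis using assms(3,4) by simp
qed

lemma bernoulli_quotient_at_right_0: "((\<lambda>x::real. x / (exp x - 1)) \<longlongrightarrow> 1) (at_right 0)"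
proof -
  have "((\<lambda>x::real. (exp x - 1) / x) \<longlongrightarrow> 1) (at 0)"
    using DERIV_exp[of "0::real"] by (simp add: has_field_derivative_iff)
  then have "((\<lambda>x::real. inverse ((exp x - 1) / x)) \<longlongrightarrow> inverse 1) (at 0)"
    by (intro tendsto_inverse) auto
  then show ?thesis by (simp add: filterlim_at_split)
qed

text \<open>
  The chord from the limit point \<open>(0, 1)\<close>: the limit of the chords over \<open>[e, a]\<close> as \<open>e\<close> tends to \<open>0\<close>.
  A limit is needed since the quotient itself takes the value \<open>0 / 0 = 0\<close> at the origin.
\<close>
lemma bernoulli_quotient_le_chord_0:
  fixes a x :: real
  assumes "0 < x" "x \<le> a"
  defines "f \<equiv> \<lambda>x::real. x / (exp x - 1)"
  shows "f x \<le> (f a - 1) / a * x + 1"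
proof (cases "x = a")
  case False
  have "((\<lambda>e. (f a - f e) / (a - e) * (x - e) + f e) \<longlongrightarrow> (f a - 1) / (a - 0) * (x - 0)
      + 1) (at_right 0)"
    unfolding f_def using assms by (intro tendsto_intros bernoulli_quotient_at_right_0) auto
  moreover have "eventually (\<lambda>e. f x \<le> (f a - f e) / (a - e) * (x - e) + f e) (at_right 0)"
    using eventually_at_right_real[OF assms(1)]
    unfolding f_def
    by eventually_elim (rule bernoulli_quotient_le_chord, use assms(2) False in auto)
  ultimately show ?thesis
    by (intro tendsto_lowerbound[of _ "(f a - 1) / a * x + 1" "at_right (0::real)"]) auto
qed (use assms in auto)

section \<open>A piecewise linear majorant of \<open>e\<^bsup>-p/x\<^esup>\<close>\<close>

text \<open>
  Here \<open>2a\<close> is \<open>p\<close>, and the right-hand side is the chord from the origin to the inflection point.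
  With \<open>t = a / x \<ge> 1\<close> the claim is \<open>t \<le> e\<^bsup>2 (t - 1)\<^esup>\<close>, which follows from \<open>t \<le> 1 + 2 (t - 1)\<close>.
\<close>
lemma exp_neg_inverse_le_chord:
  fixes a x :: real
  assumes "0 < x" "x \<le> a"
  shows "exp (- (2 * a) / x) \<le> exp (-2) * x / a"
proof -
  define t where "t = a / x"
  have t: "t \<ge> 1" using assms by (simp add: t_def)
  have "t \<le> 1 + 2 * (t - 1)" using t by simp
  also have "\<dots> \<le> exp (2 * (t - 1))" by (rule exp_ge_add_one_self)
  finally have "t * exp (- 2 * t) \<le> exp (2 * (t - 1)) * exp (- 2 * t)"
    by (intro mult_right_mono) auto
  also have "\<dots> = exp (-2)" by (simp flip: exp_add)
  finally have "exp (-2 * t) \<le> exp (-2) / t" using t by (simp add: field_simps)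
  then show ?thesis using assms by (simp add: t_def)
qed

text \<open>
  The estimate \<open>u \<le> artanh u\<close>: the derivative of the difference is \<open>2 / (1 - u\<^sup>2) - 2 \<ge> 0\<close>.
\<close>
lemma two_mul_le_ln_quotient:
  fixes u :: real
  assumes "0 \<le> u" "u < 1"
  shows "2 * u \<le> ln (1 + u) - ln (1 - u)"
proof -
  define g where "g = (\<lambda>u::real. ln (1 + u) - ln (1 - u) - 2 * u)"
  have "g 0 \<le> g u"
  proof (rule DERIV_nonneg_imp_nondecreasing[OF assms(1)])
    fix x assume x: "0 \<le> x" "x \<le> u"
    then have x': "x < 1" using assms by auto
    have "(g has_real_derivative (1 / (1 + x) + 1 / (1 - x) - 2)) (at x)"
      unfolding g_def using x x' by (auto intro!: derivative_eq_intros simp: divide_simps)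
    moreover have "1 / (1 + x) + 1 / (1 - x) - 2 = 2 * x\<^sup>2 / ((1 + x) * (1 - x))"
      using x x' by (simp add: divide_simps) (simp add: algebra_simps power2_eq_square)
    moreover have "2 * x\<^sup>2 / ((1 + x) * (1 - x)) \<ge> 0" using x x' by auto
    ultimately show "\<exists>y. (g has_real_derivative y) (at x) \<and> 0 \<le> y" by auto
  qed
  then show ?thesis by (simp add: g_def)
qed

text \<open>
  The right-hand side is the tangent at the inflection point \<open>a\<close>. With \<open>u = 1 - a / x\<close> the claim is
  \<open>e\<^bsup>2u\<^esup> \<le> (1 + u) / (1 - u)\<close>.
\<close>
lemma exp_neg_inverse_le_tangent:
  fixes a x :: real
  assumes "0 < a" "a \<le> x"
  shows "exp (- (2 * a) / x) \<le> exp (-2) * (2 * x / a - 1)"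
proof -
  define u where "u = 1 - a / x"
  have u: "0 \<le> u" "u < 1" using assms by (auto simp: u_def)
  have "exp (2 * u) \<le> exp (ln (1 + u) - ln (1 - u))"
    using two_mul_le_ln_quotient[OF u] by simp
  also have "\<dots> = (1 + u) / (1 - u)" using u by (simp add: exp_diff)
  also have "\<dots> = 2 * x / a - 1" using assms by (simp add: u_def field_simps)
  finally have "exp (-2) * exp (2 * u) \<le> exp (-2) * (2 * x / a - 1)" by (intro mult_left_mono) auto
  also have "exp (-2) * exp (2 * u) = exp (- (2 * a) / x)"
      by (simp add: u_def algebra_simps flip: exp_add)
  finally show ?thesis .
qed

section \<open>Riemann's integral for \<open>\<Gamma>(s) \<zeta>(s)\<close>\<close>

text \<open>
  Tonelli's theorem: the integral of the sum of the norms is finite, so this sum is finite almost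
  everywhere. This supplies the pointwise summability needed for interchanging sum and integral.
\<close>
lemma AE_summable_norm_if_summable_integral_norm:
  fixes f :: "nat \<Rightarrow> 'a \<Rightarrow> real"
  assumes int: "\<And>i. integrable M (f i)"
    and sum: "summable (\<lambda>i. \<integral>x. norm (f i x) \<partial>M)"
  shows "AE x in M. summable (\<lambda>i. norm (f i x))"
proof -
  have [measurable]: "f i \<in> borel_measurable M" for i using int by auto
  have "(\<integral>\<^sup>+x. (\<Sum>i. ennreal (norm (f i x))) \<partial>M) = (\<Sum>i. \<integral>\<^sup>+x. ennreal (norm (f i x)) \<partial>M)"
    by (rule nn_integral_suminf) measurable
  also have "\<dots> = (\<Sum>i. ennreal (\<integral>x. norm (f i x) \<partial>M))"
    by (intro suminf_cong nn_integral_eq_integral integrable_norm int) auto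
  also have "\<dots> \<noteq> \<infinity>"
    using sum by (simp add: ennreal_suminf_neq_top)
  finally have "AE x in M. (\<Sum>i. ennreal (norm (f i x))) \<noteq> \<infinity>"
    by (intro nn_integral_PInf_AE) auto
  then show ?thesis
    by eventually_elim (auto intro!: summable_suminf_not_top)
qed

lemma has_bochner_integral_powr_exp:
  fixes s c :: real
  assumes s: "s > 0" and c: "c > 0"
  shows "has_bochner_integral lborel (\<lambda>x. indicator {0<..} x * (x powr (s - 1) * exp (- (c * x))))
           (Gamma s / c powr s)"
proof -
  define h where "h = (\<lambda>x. indicator {0<..} x * (x powr (s - 1) * exp (- (c * x))))"
  have [measurable]: "h \<in> borel_measurable borel" unfolding h_def by measurable
  have *: "ennreal (Gamma s) = c * (\<integral>\<^sup>+x. ennreal (indicator {0..} (c * x)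
      * (c * x) powr (s - 1) / exp (c * x)) \<partial>lborel)"
    unfolding Gamma_conv_nn_integral_real[OF s]
    by (subst nn_integral_real_affine[where t = 0 and c = c]) (use c in auto)
  also have "(\<integral>\<^sup>+x. ennreal (indicator {0..} (c * x) * (c * x) powr (s - 1) / exp (c * x)) \<partial>lborel)
      = (\<integral>\<^sup>+x. ennreal (c powr (s - 1)) * ennreal (h x) \<partial>lborel)"
    by (intro nn_integral_cong)
      (use c in \<open>auto simp: h_def indicator_def zero_le_mult_iff powr_mult exp_minus
          field_simps simp flip: ennreal_mult'\<close>)
  also have "\<dots> = ennreal (c powr (s - 1)) * (\<integral>\<^sup>+x. ennreal (h x) \<partial>lborel)"
    by (rule nn_integral_cmult) measurable
  finally have eq: "ennreal (Gamma s) = ennreal (c powr s) * (\<integral>\<^sup>+x. ennreal (h x) \<partial>lborel)"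
    using c by (simp add: mult.assoc[symmetric] powr_mult_base flip: ennreal_mult')
  have "(\<integral>\<^sup>+x. ennreal (h x) \<partial>lborel) = ennreal (1 / c powr s) * ennreal (Gamma s)"
    unfolding eq using c by (simp add: mult.assoc[symmetric] flip: ennreal_mult')
  also have "\<dots> = ennreal (Gamma s / c powr s)"
    by (simp flip: ennreal_mult')
  finally show ?thesis
    using s unfolding h_def[symmetric]
    by (intro has_bochner_integral_nn_integral) (auto simp: h_def intro: less_imp_le)
qed

lemma summable_Suc_powr: "s > 1 \<Longrightarrow> summable (\<lambda>n. 1 / real (Suc n) powr s)"
  using summable_real_powr_iff[of "-s"] summable_Suc_iff[of "\<lambda>n. real n powr - s"]
  by (simp add: powr_minus_divide)

text \<open>
  Riemann's integral for \<open>\<Gamma>(s) \<zeta>(s)\<close>, from the geometric series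
  \<open>1 / (e\<^sup>x - 1) = \<Sum> e\<^bsup>-(n+1)x\<^esup>\<close> integrated term by term.
\<close>
lemma has_bochner_integral_Gamma_zeta:
  fixes s :: real
  assumes s: "s > 1"
  shows "has_bochner_integral lborel (\<lambda>x. indicator {0<..} x * (x powr (s - 1) / (exp x - 1)))
           (Gamma s * riemann_zeta s)"
proof -
  define f where "f = (\<lambda>n x. indicator {0<..} x * (x powr (s - 1) * exp (- (real (Suc n) * x))))"
  have f: "has_bochner_integral lborel (f n) (Gamma s / real (Suc n) powr s)" for n
    unfolding f_def using s by (intro has_bochner_integral_powr_exp) auto
  have norm_f: "norm (f n x) = f n x" for n x by (simp add: f_def)
  have geo: "(\<lambda>n. f n x) sums (indicator {0<..} x * (x powr (s - 1) / (exp x - 1)))" for x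
  proof (cases "x > 0")
    case True
    have "(\<lambda>n. exp (-x) ^ n) sums (1 / (1 - exp (-x)))"
      using True by (intro geometric_sums) auto
    then have "(\<lambda>n. x powr (s - 1) * exp (-x) * exp (-x) ^ n) sums (x powr (s - 1) * exp (-x)
        * (1 / (1 - exp (-x))))"
      by (rule sums_mult)
    also have "(\<lambda>n. x powr (s - 1) * exp (-x) * exp (-x) ^ n) = (\<lambda>n. f n x)"
      using True by (auto simp: f_def fun_eq_iff algebra_simps simp flip: exp_of_nat_mult exp_add)
    also have "x powr (s - 1) * exp (-x) * (1 / (1 - exp (-x)))
        = indicator {0<..} x * (x powr (s - 1) / (exp x - 1))"
      using True by (simp add: exp_minus field_simps)
    finally show ?thesis .
  qed (simp add: f_def)
  have sm: "summable (\<lambda>n. Gamma s / real (Suc n) powr s)"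
    using summable_mult[OF summable_Suc_powr[OF s], of "Gamma s"] by simp
  have int: "integrable lborel (f n)"
    "integral\<^sup>L lborel (f n) = Gamma s / real (Suc n) powr s" for n
    using f[of n] by (auto simp: has_bochner_integral_iff)
  have ae: "AE x in lborel. summable (\<lambda>n. norm (f n x))"
    unfolding norm_f using geo by (auto simp: sums_iff)
  have sn: "summable (\<lambda>n. \<integral>x. norm (f n x) \<partial>lborel)"
    unfolding norm_f int by (rule sm)
  have eq: "(\<lambda>x. \<Sum>n. f n x) = (\<lambda>x. indicator {0<..} x * (x powr (s - 1) / (exp x - 1)))"
    using geo by (auto simp: sums_iff)
  have "integral\<^sup>L lborel (\<lambda>x. \<Sum>n. f n x) = (\<Sum>n. Gamma s / real (Suc n) powr s)"
    using integral_suminf[OF int(1) ae sn] by (simp only: int)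
  also have "\<dots> = Gamma s * riemann_zeta s"
    unfolding riemann_zeta_def using suminf_mult[OF summable_Suc_powr[OF s], of "Gamma s"] by simp
  finally show ?thesis
    using integrable_suminf[OF int(1) ae sn] unfolding eq has_bochner_integral_iff by simp
qed

lemma riemann_zeta_antimono:
  assumes "1 < s" "s \<le> t"
  shows "riemann_zeta t \<le> riemann_zeta s"
  unfolding riemann_zeta_def
  using assms by (intro suminf_le summable_Suc_powr divide_left_mono powr_mono) auto

section \<open>The integral representation of the extended Mathieu series\<close>

text \<open>
  The common weight of all integrals below; for \<open>p = 0\<close> it is the Planck weight \<open>1 / (e\<^sup>x - 1)\<close>.
\<close>
definition damped_planck :: "real \<Rightarrow> real \<Rightarrow> real" where
  "damped_planck p x = exp (- p / x) / (exp x - 1)"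

lemma damped_planck_nonneg: "x > 0 \<Longrightarrow> damped_planck p x \<ge> 0"
  by (simp add: damped_planck_def)

lemma damped_planck_le: "x > 0 \<Longrightarrow> p \<ge> 0 \<Longrightarrow> damped_planck p x \<le> 1 / (exp x - 1)"
  unfolding damped_planck_def by (intro divide_right_mono) auto

lemma borel_measurable_damped_planck [measurable]: "damped_planck p \<in> borel_measurable borel"
  unfolding damped_planck_def by measurable

lemma damped_planck_moment:
  fixes s p :: real
  assumes s: "s > 1" and p: "p \<ge> 0"
  shows integrable_damped_planck_moment:
      "integrable lborel (\<lambda>x. indicator {0<..} x * (x powr (s - 1) * damped_planck p x))"
    and damped_planck_moment_le:
      "(\<integral>x. indicator {0<..} x * (x powr (s - 1) * damped_planck p x) \<partial>lborel)
          \<le> Gamma s * riemann_zeta s"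
proof -
  note zeta = has_bochner_integral_Gamma_zeta[OF s, unfolded has_bochner_integral_iff]
  have le: "x powr (s - 1) * damped_planck p x \<le> x powr (s - 1) / (exp x - 1)" if "x > 0" for x
    using mult_left_mono[OF damped_planck_le[OF that p], of "x powr (s - 1)"] by simp
  show int: "integrable lborel (\<lambda>x. indicator {0<..} x * (x powr (s - 1) * damped_planck p x))"
    by (rule Bochner_Integration.integrable_bound[OF conjunct1[OF zeta]])
      (auto intro!: le AE_I2 simp: indicator_def damped_planck_nonneg)
  show "(\<integral>x. indicator {0<..} x * (x powr (s - 1) * damped_planck p x) \<partial>lborel)
      \<le> Gamma s * riemann_zeta s"
    unfolding conjunct2[OF zeta, symmetric]
    by (rule integral_mono[OF int conjunct1[OF zeta]]) (auto simp: indicator_def intro!: le)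
qed

lemma extended_zeta_of_real:
  "extended_zeta (of_real p) (of_real s)
    = of_real (1 / Gamma s
        * (\<integral>x. indicator {0<..} x * (x powr (s - 1) * damped_planck p x) \<partial>lborel))"
proof -
  have "(LBINT x:{0<..}. complex_of_real x powr (of_real s - 1) * exp (- of_real p / of_real x)
      / (exp (of_real x) - 1))
    = (\<integral>x. complex_of_real (indicator {0<..} x * (x powr (s - 1) * damped_planck p x)) \<partial>lborel)"
    unfolding set_lebesgue_integral_def
  proof (intro Bochner_Integration.integral_cong refl)
    fix x :: real
    have "complex_of_real x powr (of_real s - 1) * exp (- of_real p / of_real x)
        / (exp (of_real x) - 1)
       = of_real (x powr (s - 1) * damped_planck p x)" if "x > 0"
    proof -
      have "complex_of_real x powr (of_real s - 1) = of_real (x powr (s - 1))"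
        using that powr_of_real[of x "s - 1"] by simp
      moreover have "exp (- complex_of_real p / of_real x) = of_real (exp (- p / x))"
        by (simp flip: exp_of_real)
      moreover have "exp (complex_of_real x) - 1 = of_real (exp x - 1)"
        by (simp add: exp_of_real)
      ultimately show ?thesis by (simp add: damped_planck_def)
    qed
    then show "indicat_real {0<..} x *\<^sub>R (complex_of_real x powr (of_real s - 1)
        * exp (- of_real p / of_real x) / (exp (of_real x) - 1))
       = of_real (indicator {0<..} x * (x powr (s - 1) * damped_planck p x))"
      by (auto simp: indicator_def)
  qed
  also have "\<dots> = of_real (\<integral>x. indicator {0<..} x * (x powr (s - 1) * damped_planck p x) \<partial>lborel)"
    by (rule integral_complex_of_real)
  finally show ?thesis
    unfolding extended_zeta_def by (simp add: Gamma_complex_of_real)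
qed

lemma Gamma_duplication_real:
  fixes z :: real
  assumes "z > 0"
  shows "Gamma z * Gamma (z + 1 / 2) = 2 powr (1 - 2 * z) * sqrt pi * Gamma (2 * z)"
proof -
  have "complex_of_real z \<notin> \<int>\<^sub>\<le>\<^sub>0" "complex_of_real (z + 1 / 2) \<notin> \<int>\<^sub>\<le>\<^sub>0"
    using assms by (auto simp only: of_real_in_nonpos_Ints_iff dest!: nonpos_Ints_nonpos)
  then have "Gamma (complex_of_real z) * Gamma (of_real (z + 1 / 2))
      = exp ((1 - 2 * of_real z) * of_real (ln 2)) * of_real (sqrt pi) * Gamma (of_real (2 * z))"
    using Gamma_legendre_duplication[of "complex_of_real z"] by simp
  also have "(1 - 2 * complex_of_real z) * of_real (ln 2) = of_real ((1 - 2 * z) * ln 2)"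
    by simp
  finally have "complex_of_real (Gamma z * Gamma (z + 1 / 2))
      = of_real (exp ((1 - 2 * z) * ln 2) * sqrt pi * Gamma (2 * z))"
    unfolding Gamma_complex_of_real exp_of_real by (simp only: of_real_mult)
  then show ?thesis
    unfolding of_real_eq_iff by (simp add: powr_def)
qed

lemma gamma_binomial_eq_gbinomial:
  assumes "\<mu> > 0"
  shows "gamma_binomial (\<mu> + real n) (real n) = (\<mu> + real n) gchoose n"
proof -
  have "\<mu> + real n + 1 \<notin> \<int>\<^sub>\<le>\<^sub>0"
    using assms by (auto dest!: nonpos_Ints_nonpos)
  from gbinomial_Gamma[OF this] show ?thesis
    by (simp add: gamma_binomial_def Gamma_fact add.commute)
qed

text \<open>
  The algebraic core of the integral representation. Since
  \<open>\<Gamma>(2\<mu> + 2n + 1)\<close> is, up to a power of \<open>2\<close> and \<open>\<surd>\<pi>\<close>, the product \<open>\<Gamma>(\<mu> + n + 1/2) \<Gamma>(\<mu> + n + 1)\<close>, its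
  second factor cancels against the numerator of the binomial coefficient, and the first one is the
  Gamma factor of the Bessel series.
\<close>
lemma mathieu_term_eq_bessel_term:
  fixes \<mu> r x :: real
  assumes \<mu>: "\<mu> > 0" and r: "r > 0" and x: "x > 0"
  shows "2 * r ^ (2 * n) * gamma_binomial (\<mu> + real n) (real n) / Gamma (2 * \<mu> + 2 * real n + 1)
            * x powr (2 * \<mu> + 2 * real n)
       = sqrt pi / ((2 * r) powr (\<mu> - 1 / 2) * Gamma (\<mu> + 1)) * (x powr (\<mu> + 1 / 2)
            * (1 / fact n * rGamma (\<mu> - 1 / 2 + real n + 1)
               * (r * x / 2) powr (\<mu> - 1 / 2 + 2 * real n)))"
proof -
  define G1 where "G1 = Gamma (\<mu> + real n + 1 / 2)"
  define G2 where "G2 = Gamma (\<mu> + real n + 1)"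
  define u v w where "u = r powr (\<mu> - 1 / 2)" and "v = x powr (\<mu> - 1 / 2)"
      and "w = 2 powr (\<mu> - 1 / 2)"
  have pos: "G1 > 0" "G2 > 0" "u > 0" "v > 0" "w > 0" "Gamma (\<mu> + 1) > 0"
    using \<mu> r x by (auto simp: G1_def G2_def u_def v_def w_def intro!: Gamma_real_pos)
  have pow: "y powr (c + 2 * real n) = y powr c * y ^ (2 * n)" if "y > 0" for y c :: real
    using that powr_realpow[of y "2 * n"] by (simp add: powr_add)
  have dup: "G1 * G2 = 2 powr (1 - 2 * (\<mu> + real n + 1 / 2)) * sqrt pi
      * Gamma (2 * (\<mu> + real n + 1 / 2))"
    using Gamma_duplication_real[of "\<mu> + real n + 1 / 2"] \<mu> by (simp add: G1_def G2_def add_ac)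
  have "2 powr (1 - 2 * (\<mu> + real n + 1 / 2)) = 1 / (2 powr (2 * \<mu> + 2 * real n))"
    by (simp add: powr_minus_divide[symmetric] algebra_simps)
  also have "2 powr (2 * \<mu> + 2 * real n) = 2 * w * w * 2 ^ (2 * n)"
  proof -
    have "(2::real) powr (2 * \<mu>) = 2 powr (1 + (\<mu> - 1 / 2) + (\<mu> - 1 / 2))" by simp
    also have "\<dots> = 2 * w * w" unfolding powr_add w_def by simp
    finally show ?thesis by (simp add: pow)
  qed
  finally have "G1 * G2 = sqrt pi * Gamma (2 * \<mu> + 2 * real n + 1) / (2 * w * w * 2 ^ (2 * n))"
    using dup by (simp add: algebra_simps)
  then have G: "Gamma (2 * \<mu> + 2 * real n + 1) = G1 * G2 * (2 * w * w * 2 ^ (2 * n)) / sqrt pi"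
    using pos by (simp add: field_simps)
  have x1: "x powr (2 * \<mu> + 2 * real n) = x powr (\<mu> + 1 / 2) * v * x ^ (2 * n)"
  proof -
    have "x powr (2 * \<mu>) = x powr ((\<mu> + 1 / 2) + (\<mu> - 1 / 2))" by simp
    also have "\<dots> = x powr (\<mu> + 1 / 2) * v" unfolding powr_add v_def by simp
    finally show ?thesis using x by (simp add: pow)
  qed
  have "(r * x / 2) powr (\<mu> - 1 / 2) = u * v / w"
    using r x by (simp add: powr_mult powr_divide u_def v_def w_def)
  moreover have "(r * x / 2) ^ (2 * n) = r ^ (2 * n) * x ^ (2 * n) / 2 ^ (2 * n)"
    by (simp only: power_mult_distrib power_divide)
  ultimately have x2: "(r * x / 2) powr (\<mu> - 1 / 2 + 2 * real n)
      = u * v / w * (r ^ (2 * n) * x ^ (2 * n) / 2 ^ (2 * n))"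
    using r x by (simp add: pow)
  have x3: "(2 * r) powr (\<mu> - 1 / 2) = w * u"
    using r by (simp add: powr_mult u_def w_def)
  have B: "gamma_binomial (\<mu> + real n) (real n) = G2 / (fact n * Gamma (\<mu> + 1))"
    by (simp add: gamma_binomial_def G2_def Gamma_fact add.commute)
  have R: "rGamma (\<mu> - 1 / 2 + real n + 1) = 1 / G1"
    by (simp add: rGamma_inverse_Gamma G1_def inverse_eq_divide algebra_simps)
  have sp: "sqrt pi > 0" by simp
  show ?thesis
    unfolding G x1 x2 x3 B R using pos sp by (simp add: divide_simps)
qed

text \<open>
  For \<open>r < 1\<close> the interchange rests on the bound \<open>2 \<zeta>(2\<mu> + 1) r\<^bsup>2n\<^esup> (\<mu>+n choose n)\<close> for the \<open>L\<^sup>1\<close> norm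
  of the \<open>n\<close>-th term: the moments are at most \<open>\<Gamma>(2\<mu> + 2n + 1) \<zeta>(2\<mu> + 2n + 1)\<close>, the Gamma factor cancels
  and \<open>\<zeta>\<close> is decreasing.
\<close>
theorem extended_mathieu_integral_representation:
  fixes p \<mu> r :: real
  assumes p: "p \<ge> 0" and \<mu>: "\<mu> > 0" and r: "r > 0"
  shows "extended_mathieu \<mu> (of_real p) r
    = of_real (sqrt pi / ((2 * r) powr (\<mu> - 1 / 2) * Gamma (\<mu> + 1)) *
        (\<integral>x. indicator {0<..} x * (x powr (\<mu> + 1 / 2) * damped_planck p x
            * bessel_J (\<mu> - 1 / 2) (r * x)) \<partial>lborel))"
proof -
  define h where "h = (\<lambda>x. indicator {0<..} x
      * (x powr (\<mu> + 1 / 2) * damped_planck p x * bessel_J (\<mu> - 1 / 2) (r * x)))"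
  show ?thesis
  proof (cases "r < 1")
    case False
    have "(LBINT x:{0<..}. of_real (x powr (\<mu> + 1 / 2)) * exp (- of_real p / of_real x)
        / (exp (of_real x) - 1)
                  * complex_of_real (bessel_J (\<mu> - 1 / 2) (r * x)))
      = (\<integral>x. complex_of_real (h x) \<partial>lborel)"
      unfolding set_lebesgue_integral_def
    proof (intro Bochner_Integration.integral_cong refl)
      fix x :: real
      have "exp (- complex_of_real p / of_real x) = of_real (exp (- p / x))"
        by (simp flip: exp_of_real)
      moreover have "exp (complex_of_real x) - 1 = of_real (exp x - 1)"
        by (simp add: exp_of_real)
      ultimately show "indicat_real {0<..} x *\<^sub>R (complex_of_real (x powr (\<mu> + 1 / 2))
          * exp (- of_real p / of_real x) / (exp (of_real x) - 1)
           * of_real (bessel_J (\<mu> - 1 / 2) (r * x)))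
         = of_real (h x)"
        by (simp add: h_def damped_planck_def indicator_def)
    qed
    also have "\<dots> = of_real (\<integral>x. h x \<partial>lborel)"
      by (rule integral_complex_of_real)
    finally show ?thesis
      using False r unfolding extended_mathieu_def h_def[symmetric] by simp
  next
    case True
    define A where "A = sqrt pi / ((2 * r) powr (\<mu> - 1 / 2) * Gamma (\<mu> + 1))"
    define m where "m = (\<lambda>n x. indicator {0<..} x
        * (x powr (2 * \<mu> + 2 * real n) * damped_planck p x))"
    define c where "c = (\<lambda>n. 2 * r ^ (2 * n) * gamma_binomial (\<mu> + real n) (real n)
        / Gamma (2 * \<mu> + 2 * real n + 1))"
    define f where "f = (\<lambda>n x. (-1) ^ n * c n * m n x)"
    have gpos: "Gamma (2 * \<mu> + 2 * real n + 1) > 0" for n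
      using \<mu> by (intro Gamma_real_pos) auto
    have bpos: "gamma_binomial (\<mu> + real n) (real n) \<ge> 0" for n
      using \<mu> unfolding gamma_binomial_def
          by (auto intro!: divide_nonneg_pos mult_pos_pos less_imp_le Gamma_real_pos)
    have cpos: "c n \<ge> 0" for n
      unfolding c_def using gpos[of n] bpos[of n] r
          by (intro divide_nonneg_pos mult_nonneg_nonneg) auto
    have mpos: "m n x \<ge> 0" for n x
      by (simp add: m_def indicator_def damped_planck_nonneg)
    have m: "integrable lborel (m n)"
        "integral\<^sup>L lborel (m n) \<le> Gamma (2 * \<mu> + 2 * real n + 1)
            * riemann_zeta (2 * \<mu> + 2 * real n + 1)" for n
      using integrable_damped_planck_moment[of "2 * \<mu> + 2 * real n + 1" p]
        damped_planck_moment_le[of "2 * \<mu> + 2 * real n + 1" p] \<mu> p by (auto simp: m_def)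
    have int: "integrable lborel (f n)" for n
      unfolding f_def by (intro integrable_mult_right m)
    have norm_f: "norm (f n x) = c n * m n x" for n x
      using cpos[of n] mpos[of n x] by (simp add: f_def abs_mult)
    have sum_norm: "summable (\<lambda>n. \<integral>x. norm (f n x) \<partial>lborel)"
    proof (rule summable_comparison_test')
      \<comment> \<open>The binomial series of \<open>(1 - r\<^sup>2)\<^bsup>-(\<mu> + 1)\<^esup>\<close>.\<close>
      have "(\<lambda>n. ((- (\<mu> + 1)) gchoose n) * (- (r\<^sup>2)) ^ n) sums (1 + - (r\<^sup>2)) powr (- (\<mu> + 1))"
        using r True by (intro gen_binomial_real) (simp add: power_less_one_iff)
      also have "(\<lambda>n. ((- (\<mu> + 1)) gchoose n) * (- (r\<^sup>2)) ^ n)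
          = (\<lambda>n. r ^ (2 * n) * gamma_binomial (\<mu> + real n) (real n))"
      proof
        fix n
        have "(- (r\<^sup>2)) ^ n = (-1) ^ n * r ^ (2 * n)"
          by (simp add: power_minus[of "r\<^sup>2"] power_mult)
        then show "((- (\<mu> + 1)) gchoose n) * (- (r\<^sup>2)) ^ n
            = r ^ (2 * n) * gamma_binomial (\<mu> + real n) (real n)"
          unfolding gamma_binomial_eq_gbinomial[OF \<mu>] gbinomial_minus[of "\<mu> + 1"]
          by (simp add: power_mult_distrib[symmetric] mult.assoc[symmetric])
      qed
      finally show "summable (\<lambda>n. 2 * riemann_zeta (2 * \<mu> + 1)
          * (r ^ (2 * n) * gamma_binomial (\<mu> + real n) (real n)))"
        by (intro summable_mult) (auto simp: sums_iff)
      fix n :: nat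
      have "(\<integral>x. norm (f n x) \<partial>lborel) = c n * integral\<^sup>L lborel (m n)"
        unfolding norm_f by simp
      also have "\<dots> \<le> c n * (Gamma (2 * \<mu> + 2 * real n + 1) * riemann_zeta (2 * \<mu> + 1))"
        using gpos[of n] \<mu>
        by (intro mult_left_mono cpos order.trans[OF m(2)] riemann_zeta_antimono) auto
      also have "\<dots> = 2 * riemann_zeta (2 * \<mu> + 1)
          * (r ^ (2 * n) * gamma_binomial (\<mu> + real n) (real n))"
        using gpos[of n] by (simp add: c_def)
      finally show "norm (\<integral>x. norm (f n x) \<partial>lborel)
          \<le> 2 * riemann_zeta (2 * \<mu> + 1) * (r ^ (2 * n) * gamma_binomial (\<mu> + real n) (real n))"
        by simp
    qed
    note ae = AE_summable_norm_if_summable_integral_norm[OF int sum_norm]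
    have pos_sum: "(\<Sum>n. f n x) = A * h x"
      if "summable (\<lambda>n. norm (f n x))" for x
    proof (cases "x > 0")
      case x: True
      define g where "g = (\<lambda>k. (-1) ^ k / fact k * rGamma (\<mu> - 1 / 2 + real k + 1)
          * (r * x / 2) powr (\<mu> - 1 / 2 + 2 * real k))"
      define K where "K = A * x powr (\<mu> + 1 / 2) * damped_planck p x"
      have K: "K > 0" unfolding K_def A_def damped_planck_def using x \<mu> r
        by (intro mult_pos_pos divide_pos_pos) (auto intro!: Gamma_real_pos)
      have fg: "f n x = K * g n" for n
      proof -
        have "f n x = (-1) ^ n * damped_planck p x * (c n * x powr (2 * \<mu> + 2 * real n))"
          using x by (simp add: f_def m_def)
        also have "c n * x powr (2 * \<mu> + 2 * real n) = A * (x powr (\<mu> + 1 / 2)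
            * (1 / fact n * rGamma (\<mu> - 1 / 2 + real n + 1)
               * (r * x / 2) powr (\<mu> - 1 / 2 + 2 * real n)))"
          unfolding c_def A_def by (rule mathieu_term_eq_bessel_term[OF \<mu> r x])
        finally show ?thesis by (simp add: K_def g_def)
      qed
      \<comment> \<open>\<open>K \<noteq> 0\<close> transfers summability from the Mathieu terms to the Bessel series.\<close>
      have "summable g"
        using summable_norm_cancel[OF that] K by (simp add: fg)
      then have "(\<Sum>n. f n x) = K * (\<Sum>n. g n)"
        unfolding fg by (rule suminf_mult)
      also have "(\<Sum>n. g n) = bessel_J (\<mu> - 1 / 2) (r * x)"
        unfolding g_def bessel_J_def ..
      finally show ?thesis using x by (simp add: K_def h_def)
    qed (simp add: f_def m_def h_def)
    have "(\<Sum>n. integral\<^sup>L lborel (f n)) = (\<integral>x. (\<Sum>n. f n x) \<partial>lborel)"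
      by (rule integral_suminf[symmetric, OF int ae sum_norm])
    also have "\<dots> = (\<integral>x. A * h x \<partial>lborel)"
    proof (rule integral_cong_AE)
      have [measurable]: "f n \<in> borel_measurable lborel" for n using int by auto
      show "(\<lambda>x. \<Sum>n. f n x) \<in> borel_measurable lborel" by measurable
      show "(\<lambda>x. A * h x) \<in> borel_measurable lborel"
        unfolding h_def bessel_J_def by measurable
      show "AE x in lborel. (\<Sum>n. f n x) = A * h x"
        using ae by eventually_elim (rule pos_sum)
    qed
    finally have main: "(\<Sum>n. integral\<^sup>L lborel (f n)) = A * (\<integral>x. h x \<partial>lborel)"
      by simp
    have sf: "summable (\<lambda>n. integral\<^sup>L lborel (f n))"
      by (rule summable_integral[OF int ae sum_norm])
    have term_eq: "(-1) ^ n * of_real (r ^ (2 * n)) * of_real (gamma_binomial (\<mu> + real n) (real n))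
        * extended_zeta (of_real p) (of_real (2 * \<mu> + 2 * real n + 1)) =
        of_real (integral\<^sup>L lborel (f n) / 2)" for n
    proof -
      have "integral\<^sup>L lborel (f n) = (-1) ^ n * c n * integral\<^sup>L lborel (m n)"
        unfolding f_def by simp
      then show ?thesis
        unfolding extended_zeta_of_real c_def m_def by simp
    qed
    have "extended_mathieu \<mu> (of_real p) r = 2 * (\<Sum>n. of_real (integral\<^sup>L lborel (f n) / 2))"
      unfolding extended_mathieu_def term_eq using True r by simp
    also have "\<dots> = of_real (\<Sum>n. integral\<^sup>L lborel (f n))"
      using suminf_of_real[OF summable_divide[OF sf, of 2], where 'a = complex]
        suminf_divide[OF sf, of 2] by simp
    finally show ?thesis unfolding main A_def h_def .
  qed
qed

section \<open>Bounding the moment by interpolation\<close>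

lemma has_bochner_integral_powr_from_0:
  fixes t c :: real
  assumes "t > -1" "c \<ge> 0"
  shows "has_bochner_integral lborel (\<lambda>x. indicator {0..c} x * x powr t) (c powr (t + 1) / (t + 1))"
proof (rule has_bochner_integral_nn_integral)
  have "(\<lambda>x. indicator {0..c} x * x powr t) = (\<lambda>x. if x \<in> {0..c} then x powr t else 0)"
    by (auto simp: fun_eq_iff)
  then have "((\<lambda>x. indicator {0..c} x * x powr t) has_integral c powr (t + 1) / (t + 1)) UNIV"
    using has_integral_powr_from_0[OF assms] by (simp only: has_integral_restrict_UNIV)
  then show "(\<integral>\<^sup>+x. ennreal (indicator {0..c} x * x powr t) \<partial>lborel)
      = ennreal (c powr (t + 1) / (t + 1))"
    by (intro nn_integral_has_integral_lborel) auto
qed (use assms in auto)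

text \<open>
  Here \<open>p = 2a\<close>, and \<open>b\<close> is the point at which the majorant of \<open>e\<^bsup>-p/x\<^esup>\<close> switches from the
  tangent to the constant \<open>1\<close>. The integrands are compared pointwise: the one on the left is at
  most \<open>x\<^sup>s / (e\<^sup>x - 1)\<close> plus a function that is integrated by the power rule.
\<close>
lemma damped_planck_moment_le_interpolation:
  fixes a b s :: real
  assumes a: "0 < a" and b: "a < b" and s: "s > 0"
  defines "f \<equiv> \<lambda>x::real. x / (exp x - 1)"
  defines "K1 \<equiv> (f b - f a) / (b - a)"
    and "K2 \<equiv> (1 / (exp a - 1) - 1 / (exp b - 1)) * (a * b / (b - a))"
  shows "(\<integral>x. indicator {0<..} x * (x powr s * damped_planck (2 * a) x) \<partial>lborel)
    \<le> Gamma (s + 1) * riemann_zeta (s + 1)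
      + exp (-2) / a * (a powr (s + 1) / (s + 1) + (f a - 1) / a * (a powr (s + 2) / (s + 2)))
      + exp (-2) * (2 / a * (K1 * ((b powr (s + 2) - a powr (s + 2)) / (s + 2))
                             + K2 * ((b powr (s + 1) - a powr (s + 1)) / (s + 1)))
                    - f b * ((b powr s - a powr s) / s))
      - f b * (b powr s / s)"
proof -
  \<comment> \<open>The majorant is \<open>x\<^sup>s / (e\<^sup>x - 1) + M\<close> with \<open>M\<close> supported on \<open>[0, b]\<close>. The tangent part on
    \<open>[a, b]\<close> is written as the part on \<open>[0, b]\<close> minus the part on \<open>[0, a]\<close>, so that every summand
    is a power on an interval starting at \<open>0\<close>.\<close>
  define P where "P = (\<lambda>t c x. indicator {0..c} x * x powr t :: real)"
  define M2 where "M2 = (\<lambda>c x. exp (-2)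
      * (2 / a * (K1 * P (s + 1) c x + K2 * P s c x) - f b * P (s - 1) c x))"
  define M where "M = (\<lambda>x. exp (-2) / a * (P s a x + (f a - 1) / a * P (s + 1) a x)
      + (M2 b x - M2 a x) - f b * P (s - 1) b x)"
  note zeta = has_bochner_integral_Gamma_zeta[of "s + 1"]
  have P: "has_bochner_integral lborel (P t c) (c powr (t + 1)
      / (t + 1))" if "t > -1" "c \<ge> 0" for t c
    unfolding P_def by (rule has_bochner_integral_powr_from_0[OF that])
  have P': "has_bochner_integral lborel (P (s - 1) c) (c powr s / s)"
    "has_bochner_integral lborel (P s c) (c powr (s + 1) / (s + 1))"
    "has_bochner_integral lborel (P (s + 1) c) (c powr (s + 2) / (s + 2))" if "c \<ge> 0" for c
    using P[of "s - 1" c] P[of s c] P[of "s + 1" c] that s by (simp_all add: add.assoc)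
  define I2 where "I2 = (\<lambda>c. exp (-2) * (2 / a * (K1 * (c powr (s + 2) / (s + 2))
      + K2 * (c powr (s + 1) / (s + 1))) - f b * (c powr s / s)))"
  have M2: "has_bochner_integral lborel (M2 c) (I2 c)" if "c \<ge> 0" for c
    unfolding M2_def I2_def
    by (intro has_bochner_integral_mult_right has_bochner_integral_add
        has_bochner_integral_diff P' that)
  have M: "has_bochner_integral lborel M
     (exp (-2) / a * (a powr (s + 1) / (s + 1) + (f a - 1) / a * (a powr (s + 2) / (s + 2)))
      + (I2 b - I2 a)
      - f b * (b powr s / s))" (is "has_bochner_integral _ _ ?I")
    unfolding M_def using a b
    by (intro has_bochner_integral_mult_right has_bochner_integral_add
        has_bochner_integral_diff P' M2) auto
  \<comment> \<open>After division by \<open>y = x\<^bsup>s - 1\<^esup>\<close> the claim compares \<open>f x \<cdot> E\<close> with \<open>f x\<close> plus a correction.\<close>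
  have pointwise: "x powr s * damped_planck (2 * a) x
      \<le> x powr s / (exp x - 1) + M x" if x: "x > 0" for x
  proof -
    define y where "y = x powr (s - 1)"
    define E where "E = exp (- (2 * a) / x)"
    have y: "y \<ge> 0" by (simp add: y_def)
    have "x powr s = y * x"
      using x powr_mult_base[of x "s - 1"] by (simp add: y_def mult.commute)
    moreover have "x powr (s + 1) = x powr s * x"
      using x by (simp add: powr_add)
    ultimately have xs: "x powr s = y * x" "x powr (s + 1) = y * x\<^sup>2"
      by (simp_all add: power2_eq_square)
    have lhs: "x powr s * damped_planck (2 * a) x = y * (f x * E)"
      "x powr s / (exp x - 1) = y * f x"
      by (simp_all add: damped_planck_def E_def f_def xs)
    have fpos: "f x > 0" using x by (simp add: f_def)
    have E1: "E \<le> 1" using a x by (simp add: E_def)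
    consider "x \<le> a" | "a < x" "x \<le> b" | "b < x" by linarith
    then show ?thesis
    proof cases
      case 1
      have "M x = exp (-2) / a * (x powr s + (f a - 1) / a * x powr (s + 1)) - f b * y"
        using 1 b x by (simp add: M_def M2_def P_def y_def)
      also have "\<dots> = y * (exp (-2) * x / a * ((f a - 1) / a * x + 1) - f b)"
        using a unfolding xs by (simp add: field_simps power2_eq_square)
      finally have M: "M x = y * (exp (-2) * x / a * ((f a - 1) / a * x + 1) - f b)" .
      have "f x * E \<le> ((f a - 1) / a * x + 1) * (exp (-2) * x / a)"
        using bernoulli_quotient_le_chord_0[OF x 1] exp_neg_inverse_le_chord[OF x 1] fpos
        unfolding f_def[symmetric] E_def by (intro mult_mono) (auto simp: f_def)
      moreover have "f b \<le> f x"
        using bernoulli_quotient_antimono[of x b] x 1 b by (simp add: f_def)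
      ultimately have "f x * E \<le> f x + (exp (-2) * x / a * ((f a - 1) / a * x + 1) - f b)"
        by (simp add: mult.commute)
      from mult_left_mono[OF this y] show ?thesis unfolding lhs M by (simp add: distrib_left)
    next
      case 2
      have "M x = exp (-2) * (2 / a * (K1 * x powr (s + 1) + K2 * x powr s) - f b * y) - f b * y"
        using 2 b x by (simp add: M_def M2_def P_def y_def)
      also have "\<dots> = y * (exp (-2) * (2 * x / a * (K1 * x + K2) - f b) - f b)"
        using a unfolding xs by (simp add: field_simps power2_eq_square)
      finally have M: "M x = y * (exp (-2) * (2 * x / a * (K1 * x + K2) - f b) - f b)" .
      have chord: "K1 * x + K2 = (f b - f a) / (b - a) * (x - a) + f a"
      proof -
        have "K2 = f a - a * K1"
          using a b unfolding K1_def K2_def f_def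
              by (simp add: divide_simps) (simp add: algebra_simps)
        then show ?thesis unfolding K1_def[symmetric] by (simp add: algebra_simps)
      qed
      have fb: "f b \<le> f x"
        using bernoulli_quotient_antimono[of x b] x 2 by (simp add: f_def)
      have "f x * E \<le> f x * (exp (-2) * (2 * x / a - 1))"
        using exp_neg_inverse_le_tangent[OF a, of x] 2 fpos
            by (intro mult_left_mono) (auto simp: E_def)
      also have "\<dots> = exp (-2) * (2 * x / a * f x - f x)" by (simp add: algebra_simps)
      also have "\<dots> \<le> exp (-2) * (2 * x / a * (K1 * x + K2) - f b)"
        using bernoulli_quotient_le_chord[OF a b, of x] 2 x a fb
        unfolding chord f_def[symmetric] by (intro mult_left_mono diff_mono) (auto simp: f_def)
      finally have "f x * E \<le> f x + (exp (-2) * (2 * x / a * (K1 * x + K2) - f b) - f b)"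
        using fb by simp
      from mult_left_mono[OF this y] show ?thesis unfolding lhs M by (simp add: distrib_left)
    next
      case 3
      then have "M x = 0" using b by (simp add: M_def M2_def P_def)
      moreover have "y * (f x * E) \<le> y * (f x * 1)" using y fpos E1 by (intro mult_left_mono) auto
      ultimately show ?thesis unfolding lhs by simp
    qed
  qed
  have "(\<integral>x. indicator {0<..} x * (x powr s * damped_planck (2 * a) x) \<partial>lborel)
    \<le> (\<integral>x. indicator {0<..} x * (x powr s / (exp x - 1)) + M x \<partial>lborel)"
  proof (rule integral_mono)
    show "integrable lborel (\<lambda>x. indicator {0<..} x * (x powr s * damped_planck (2 * a) x))"
      using integrable_damped_planck_moment[of "s + 1" "2 * a"] s a by simp
    show "integrable lborel (\<lambda>x. indicator {0<..} x * (x powr s / (exp x - 1)) + M x)"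
      using zeta M s by (intro Bochner_Integration.integrable_add)
          (auto simp: has_bochner_integral_iff)
    fix x :: real
    show "indicator {0<..} x * (x powr s * damped_planck (2 * a) x)
        \<le> indicator {0<..} x * (x powr s / (exp x - 1)) + M x"
    proof (cases "x > 0")
      case False
      then have "M x = 0" by (cases "x = 0") (auto simp: M_def M2_def P_def)
      then show ?thesis using False by simp
    qed (use pointwise in simp)
  qed
  also have "\<dots> = Gamma (s + 1) * riemann_zeta (s + 1) + ?I"
    using has_bochner_integral_add[OF zeta M] s by (simp add: has_bochner_integral_iff)
  finally show ?thesis by (simp add: I2_def algebra_simps diff_divide_distrib)
qed

text \<open>
  Substituting \<open>b = a \<beta>\<close> makes \<open>e\<^bsup>-2\<^esup> a\<^sup>s\<close> a common factor of all summands.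
\<close>
lemma interpolation_bound_closed_form:
  fixes a b s \<beta> K1 K2 :: real
  assumes a: "a > 0" and \<beta>: "\<beta> > 1" and s: "s > 0"
  defines "b \<equiv> a * \<beta>"
  defines "f \<equiv> \<lambda>x::real. x / (exp x - 1)"
  shows "exp (-2) / a * (a powr (s + 1) / (s + 1) + (f a - 1) / a * (a powr (s + 2) / (s + 2)))
      + exp (-2) * (2 / a * (K1 * ((b powr (s + 2) - a powr (s + 2)) / (s + 2))
                             + K2 * ((b powr (s + 1) - a powr (s + 1)) / (s + 1)))
                    - f b * ((b powr s - a powr s) / s))
      - f b * (b powr s / s)
    = exp (-2) * a powr s *
       (1 / (2 * s + 4) * (4 / (2 * s + 2) + 2 * a / (exp a - 1))
        + 2 * K1 * (2 * a) / (2 * s + 4) * (\<beta> powr (s + 2) - 1)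
        + 4 * K2 / (2 * s + 2) * (\<beta> powr (s + 1) - 1)
        - 2 * \<beta> * (2 * a) / (2 * (2 * s) * (exp b - 1)) * (\<beta> powr s - 1)
        - exp 2 * (2 * a) * \<beta> powr (s + 1) / (2 * s * (exp b - 1)))"
proof -
  define u v X Y where "u = a powr s" and "v = \<beta> powr s" and "X = exp a - 1" and "Y = exp b - 1"
  have b: "b > 0" using a \<beta> by (simp add: b_def)
  have XY: "X > 0" "Y > 0" using a b by (auto simp: X_def Y_def)
  have pw: "a powr (s + 1) = u * a" "a powr (s + 2) = u * a\<^sup>2"
    "\<beta> powr (s + 1) = v * \<beta>" "\<beta> powr (s + 2) = v * \<beta>\<^sup>2"
    "b powr s = u * v" "b powr (s + 1) = u * v * b" "b powr (s + 2) = u * v * b\<^sup>2"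
    using a b \<beta> by (simp_all add: powr_add u_def v_def b_def powr_mult power_mult_distrib)
  have f: "f a = a / X" "f b = b / Y" by (simp_all add: f_def X_def Y_def)
  have D: "2 * s + 4 = 2 * (s + 2)" "2 * s + 2 = 2 * (s + 1)" by simp_all
  have T1: "exp (-2) / a * (u * a / (s + 1) + (a / X - 1) / a * (u * a\<^sup>2 / (s + 2)))
    = exp (-2) * u * (1 / (2 * s + 4) * (4 / (2 * s + 2) + 2 * a / X))"
  proof -
    have "u * a / (s + 1) + (a / X - 1) / a * (u * a\<^sup>2 / (s + 2))
        = u * a * (1 / (s + 1) - 1 / (s + 2) + a / X / (s + 2))"
    proof -
      \<comment> \<open>Generic denominators keep \<open>s + 1\<close> and \<open>s + 2\<close> from being multiplied out.\<close>
      have "u * a / d1 + (a / X - 1) / a * (u * a\<^sup>2 / d2) = u * a * (1 / d1 - 1 / d2 + a / X / d2)"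
        for d1 d2 :: real
        using a by (simp add: power2_eq_square algebra_simps diff_divide_distrib)
      then show ?thesis .
    qed
    also have "1 / (s + 1) - 1 / (s + 2) = 1 / ((s + 2) * (s + 1))"
      using s by (simp add: field_simps)
    also have "1 / ((s + 2) * (s + 1)) + a / X / (s + 2)
        = 1 / (2 * s + 4) * (4 / (2 * s + 2) + 2 * a / X)"
    proof -
      have "1 / (d2 * d1) + a / X / d2
          = 1 / (2 * d2) * (4 / (2 * d1) + 2 * a / X)" for d1 d2 :: real
        by (simp add: distrib_left)
      then show ?thesis unfolding D .
    qed
    finally show ?thesis using a by simp
  qed
  have cancel: "2 / a * (k * (u * (a * w) / d)) = u * (2 * k * 2 / (2 * d) * w)" for k w d :: real
    using a by simp
  have d2: "u * v * b\<^sup>2 - u * a\<^sup>2 = u * (a * (a * (v * \<beta>\<^sup>2 - 1)))"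
    unfolding b_def by algebra
  have T2: "2 / a * (K1 * ((u * v * b\<^sup>2 - u * a\<^sup>2) / (s + 2)))
      = u * (2 * K1 * (2 * a) / (2 * s + 4) * (v * \<beta>\<^sup>2 - 1))"
    unfolding D d2 cancel by simp
  have d1: "u * v * b - u * a = u * (a * (v * \<beta> - 1))"
    unfolding b_def by algebra
  have T3: "2 / a * (K2 * ((u * v * b - u * a) / (s + 1)))
      = u * (4 * K2 / (2 * s + 2) * (v * \<beta> - 1))"
    unfolding D d1 cancel by simp
  have uv: "u * v - u = u * (v - 1)" by (simp add: algebra_simps)
  have "b / Y * (u * w / s) = u * (2 * \<beta> * (2 * a) / (2 * (2 * s) * Y) * w)" for w
    by (simp add: b_def mult_ac)
  then have T4: "b / Y * ((u * v - u) / s) = u * (2 * \<beta> * (2 * a) / (2 * (2 * s) * Y) * (v - 1))"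
    unfolding uv .
  have T5: "b / Y * (u * v / s) = exp (-2) * u * (exp 2 * (2 * a) * (v * \<beta>) / (2 * s * Y))"
  proof -
    have "exp (-2) * u * (exp 2 * (2 * a) * (v * \<beta>) / (2 * s * Y))
        = (exp (-2) * exp 2) * (u * ((2 * a) * (v * \<beta>) / (2 * s * Y)))"
      by simp
    also have "exp (-2) * exp (2::real) = 1" by (simp flip: exp_add)
    finally show ?thesis by (simp add: b_def mult_ac)
  qed
  have "exp (-2) / a * (u * a / (s + 1) + (a / X - 1) / a * (u * a\<^sup>2 / (s + 2)))
      + exp (-2) * (2 / a * (K1 * ((u * v * b\<^sup>2 - u * a\<^sup>2) / (s + 2)))
                   + 2 / a * (K2 * ((u * v * b - u * a) / (s + 1))) - b / Y * ((u * v - u) / s))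
      - b / Y * (u * v / s)
    = exp (-2) * u *
       (1 / (2 * s + 4) * (4 / (2 * s + 2) + 2 * a / X)
        + 2 * K1 * (2 * a) / (2 * s + 4) * (v * \<beta>\<^sup>2 - 1)
        + 4 * K2 / (2 * s + 2) * (v * \<beta> - 1)
        - 2 * \<beta> * (2 * a) / (2 * (2 * s) * Y) * (v - 1)
        - exp 2 * (2 * a) * (v * \<beta>) / (2 * s * Y))"
    unfolding T1 T2 T3 T4 T5 by (simp only: ring_distribs mult.assoc)
  then show ?thesis
    unfolding f X_def[symmetric] Y_def[symmetric] u_def[symmetric] v_def[symmetric] pw
    by (simp only: distrib_left[of "2 / a"])
qed

section \<open>The bound for the extended Mathieu series\<close>

lemma norm_extended_mathieu_le_moment:
  fixes p \<mu> r q C :: real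
  assumes p: "p \<ge> 0" and \<mu>: "\<mu> > 0" and r: "r > 0" and q: "q > - \<mu> - 1 / 2" and C: "C > 0"
    and J: "\<And>x. x > 0 \<Longrightarrow> \<bar>bessel_J (\<mu> - 1 / 2) (r * x)\<bar> \<le> C * x powr q"
  shows "cmod (extended_mathieu \<mu> (of_real p) r)
    \<le> C * sqrt pi / ((2 * r) powr (\<mu> - 1 / 2) * Gamma (\<mu> + 1))
        * (\<integral>x. indicator {0<..} x * (x powr (\<mu> + q + 1 / 2) * damped_planck p x) \<partial>lborel)"
proof -
  define A where "A = sqrt pi / ((2 * r) powr (\<mu> - 1 / 2) * Gamma (\<mu> + 1))"
  have A: "A \<ge> 0" unfolding A_def using \<mu>
      by (auto intro!: divide_nonneg_pos mult_nonneg_nonneg less_imp_le Gamma_real_pos)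
  define g where "g = (\<lambda>x. indicator {0<..} x * (x powr (\<mu> + q + 1 / 2) * damped_planck p x))"
  define h where "h = (\<lambda>x. indicator {0<..} x
      * (x powr (\<mu> + 1 / 2) * damped_planck p x * bessel_J (\<mu> - 1 / 2) (r * x)))"
  have g: "integrable lborel g"
    using integrable_damped_planck_moment[of "(\<mu> + q + 1 / 2) + 1" p] p q
    unfolding g_def add_diff_cancel_right' by simp
  have "\<bar>\<integral>x. h x \<partial>lborel\<bar> \<le> (\<integral>x. \<bar>h x\<bar> \<partial>lborel)" by (rule integral_abs_bound)
  also have "\<dots> \<le> (\<integral>x. C * g x \<partial>lborel)"
  proof (rule integral_mono')
    fix x :: real
    show "\<bar>h x\<bar> \<le> C * g x"
    proof (cases "x > 0")
      case True
      have "\<bar>h x\<bar> = x powr (\<mu> + 1 / 2) * damped_planck p x * \<bar>bessel_J (\<mu> - 1 / 2) (r * x)\<bar>"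
        using True by (simp add: h_def abs_mult damped_planck_nonneg)
      also have "\<dots> \<le> x powr (\<mu> + 1 / 2) * damped_planck p x * (C * x powr q)"
        using True by (intro mult_left_mono J mult_nonneg_nonneg damped_planck_nonneg) auto
      also have "\<dots> = C * (x powr (\<mu> + 1 / 2 + q) * damped_planck p x)"
        by (simp add: powr_add)
      finally show ?thesis using True by (simp add: g_def add_ac)
    qed (simp add: h_def g_def)
    show "0 \<le> C * g x" using C by (simp add: g_def indicator_def damped_planck_nonneg)
  qed (use g in simp)
  finally have "\<bar>\<integral>x. h x \<partial>lborel\<bar> \<le> C * (\<integral>x. g x \<partial>lborel)" by simp
  from mult_left_mono[OF this A]
  have "\<bar>A * (\<integral>x. h x \<partial>lborel)\<bar> \<le> A * C * (\<integral>x. g x \<partial>lborel)"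
    using A by (simp add: abs_mult mult.assoc)
  moreover have "C * sqrt pi / ((2 * r) powr (\<mu> - 1 / 2) * Gamma (\<mu> + 1)) = A * C"
    by (simp add: A_def)
  ultimately show ?thesis
    unfolding extended_mathieu_integral_representation[OF p \<mu> r] A_def[symmetric] norm_of_real
    by (simp only: g_def h_def)
qed

theorem theorem4:
  fixes p \<mu> r q C a b K1 K2 :: real
  assumes "p \<ge> 0" and "\<mu> > 0" and "r > 0" and "q > - \<mu> - 1 / 2" and "C > 0"
    and "\<And>x. x > 0 \<Longrightarrow> \<bar>bessel_J (\<mu> - 1 / 2) (r * x)\<bar> \<le> C * x powr q"
  defines "a \<equiv> p / 2"
    and "b \<equiv> p / 4 * (1 + exp 2)"
    and "K1 \<equiv> (b / (exp b - 1) - a / (exp a - 1)) * (1 / (b - a))"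
    and "K2 \<equiv> (1 / (exp a - 1) - 1 / (exp b - 1)) * (a * b / (b - a))"
  shows "cmod (extended_mathieu \<mu> (complex_of_real p) r) \<le>
    (if p = 0 then 0
     else C * sqrt pi * p powr (\<mu> + q + 1 / 2)
            / (exp 2 * 2 powr (2 * \<mu> + q) * r powr (\<mu> - 1 / 2) * Gamma (\<mu> + 1)) *
       (1 / (2 * (\<mu> + q) + 5) * (4 / (2 * (\<mu> + q) + 3) + p / (exp (p / 2) - 1))
        + 2 * K1 * p / (2 * (\<mu> + q) + 5) * (((1 + exp 2) / 2) powr (\<mu> + q + 5 / 2) - 1)
        + 4 * K2 / (2 * (\<mu> + q) + 3) * (((1 + exp 2) / 2) powr (\<mu> + q + 3 / 2) - 1)
        - (1 + exp 2) * p / (2 * (2 * (\<mu> + q) + 1) * (exp (p / 4 * (1 + exp 2)) - 1))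
            * (((1 + exp 2) / 2) powr (\<mu> + q + 1 / 2) - 1)
        - exp 2 * p * (1 + exp 2) powr (\<mu> + q + 3 / 2)
            / (2 powr (\<mu> + q + 3 / 2) * (2 * (\<mu> + q) + 1) * (exp (p / 4 * (1 + exp 2)) - 1))))
    + C * sqrt pi / ((2 * r) powr (\<mu> - 1 / 2) * Gamma (\<mu> + 1))
        * Gamma (\<mu> + q + 3 / 2) * riemann_zeta (\<mu> + q + 3 / 2)"
proof -
  define s where "s = \<mu> + q + 1 / 2"
  define A where "A = C * sqrt pi / ((2 * r) powr (\<mu> - 1 / 2) * Gamma (\<mu> + 1))"
  have s: "s > 0" using assms(4) by (simp add: s_def)
  have A: "A \<ge> 0" unfolding A_def using assms(2,5)
    by (auto intro!: divide_nonneg_pos mult_nonneg_nonneg less_imp_le Gamma_real_pos)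
  have norm_le: "cmod (extended_mathieu \<mu> (complex_of_real p) r)
      \<le> A * (\<integral>x. indicator {0<..} x * (x powr s * damped_planck p x) \<partial>lborel)"
    unfolding A_def s_def by (rule norm_extended_mathieu_le_moment) (fact assms(1-6))+
  have s1: "\<mu> + q + 3 / 2 = s + 1" by (simp add: s_def)
  show ?thesis
  proof (cases "p = 0")
    case True
    have "A * (\<integral>x. indicator {0<..} x * (x powr s * damped_planck p x) \<partial>lborel)
        \<le> A * (Gamma (s + 1) * riemann_zeta (s + 1))"
      using damped_planck_moment_le[of "s + 1" p] s A assms(1) by (intro mult_left_mono) auto
    with norm_le True show ?thesis unfolding s1 A_def[symmetric] by (simp add: mult.assoc)
  next
    case False
    define \<beta> where "\<beta> = (1 + exp 2 :: real) / 2"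
    define B where "B = 1 / (2 * s + 4) * (4 / (2 * s + 2) + 2 * a / (exp a - 1))
        + 2 * K1 * (2 * a) / (2 * s + 4) * (\<beta> powr (s + 2) - 1)
        + 4 * K2 / (2 * s + 2) * (\<beta> powr (s + 1) - 1)
        - 2 * \<beta> * (2 * a) / (2 * (2 * s) * (exp b - 1)) * (\<beta> powr s - 1)
        - exp 2 * (2 * a) * \<beta> powr (s + 1) / (2 * s * (exp b - 1))"
    have p: "p > 0" "p = 2 * a" using False assms(1) by (simp_all add: a_def)
    have \<beta>: "\<beta> > 1" by (simp add: \<beta>_def)
    have b\<beta>: "b = a * \<beta>" by (simp add: a_def b_def \<beta>_def)
    have a: "a > 0" using p by simp
    have ab: "a < b" using a \<beta> by (simp add: b\<beta>)
    have K1: "(b / (exp b - 1) - a / (exp a - 1)) / (b - a) = K1" by (simp add: K1_def)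
    have "(\<integral>x. indicator {0<..} x * (x powr s * damped_planck p x) \<partial>lborel)
        \<le> exp (-2) * a powr s * B + Gamma (s + 1) * riemann_zeta (s + 1)"
      using damped_planck_moment_le_interpolation[OF a ab s]
        interpolation_bound_closed_form[OF a \<beta> s, of K1 K2]
      unfolding p(2)[symmetric] K2_def[symmetric] K1 b\<beta>[symmetric] B_def by simp
    from mult_left_mono[OF this A] norm_le
    have "cmod (extended_mathieu \<mu> (complex_of_real p) r)
        \<le> A * (exp (-2) * a powr s) * B + A * Gamma (s + 1) * riemann_zeta (s + 1)"
      by (simp add: algebra_simps)
    also have "A * (exp (-2) * a powr s) = C * sqrt pi * p powr s
            / (exp 2 * 2 powr (2 * \<mu> + q) * r powr (\<mu> - 1 / 2) * Gamma (\<mu> + 1))"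
    proof -
      have "2 powr (2 * \<mu> + q) = 2 powr (\<mu> - 1 / 2) * 2 powr s"
        unfolding powr_add[symmetric] by (simp add: s_def)
      moreover have "p powr s = 2 powr s * a powr s"
        using a by (simp add: p(2) powr_mult)
      moreover have "(2 * r) powr (\<mu> - 1 / 2) = 2 powr (\<mu> - 1 / 2) * r powr (\<mu> - 1 / 2)"
        using assms(3) by (simp add: powr_mult)
      ultimately show ?thesis by (simp add: A_def exp_minus field_simps)
    qed
    also have "B = 1 / (2 * (\<mu> + q) + 5) * (4 / (2 * (\<mu> + q) + 3) + p / (exp (p / 2) - 1))
        + 2 * K1 * p / (2 * (\<mu> + q) + 5) * (((1 + exp 2) / 2) powr (\<mu> + q + 5 / 2) - 1)
        + 4 * K2 / (2 * (\<mu> + q) + 3) * (((1 + exp 2) / 2) powr (\<mu> + q + 3 / 2) - 1)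
        - (1 + exp 2) * p / (2 * (2 * (\<mu> + q) + 1) * (exp (p / 4 * (1 + exp 2)) - 1))
            * (((1 + exp 2) / 2) powr (\<mu> + q + 1 / 2) - 1)
        - exp 2 * p * (1 + exp 2) powr (\<mu> + q + 3 / 2)
            / (2 powr (\<mu> + q + 3 / 2) * (2 * (\<mu> + q) + 1) * (exp (p / 4 * (1 + exp 2)) - 1))"
    proof -
      \<comment> \<open>After \<open>1 + e\<^sup>2 = 2 \<beta>\<close> the power \<open>2\<^bsup>s + 1\<^esup>\<close> in the last summand cancels.\<close>
      have e: "1 + exp 2 = 2 * \<beta>" "p / 4 * (2 * \<beta>) = b" "2 * \<beta> / 2 = \<beta>" "p / 2 = a"
        by (simp_all add: \<beta>_def b_def a_def)
      have pw: "(2 * \<beta>) powr (s + 1) = 2 powr (s + 1) * \<beta> powr (s + 1)"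
        by (rule powr_mult)
      have sq: "2 * (\<mu> + q) + 5 = 2 * s + 4" "2 * (\<mu> + q) + 3 = 2 * s + 2"
        "2 * (\<mu> + q) + 1 = 2 * s"
        "\<mu> + q + 5 / 2 = s + 2" "\<mu> + q + 3 / 2 = s + 1" "\<mu> + q + 1 / 2 = s"
        by (simp_all add: s_def)
      show ?thesis
        unfolding sq e pw B_def p(2)[symmetric] by (simp add: mult.assoc)
    qed
    finally show ?thesis
      using False unfolding s1 A_def[symmetric] s_def[symmetric] by simp
  qed
qed

end
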